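(* Let $\ell>0$ be an integer. Then $F(\ell-\log_2 B(\ell)-1)\ge \ell$. In addition, if $B(\ell)=B(\ell+1)$, then $F(\ell-\log_2 B(\ell)-1)=\ell$.
   Context: Cards of the EvenQuads-$2^n$ deck are the elements of $\mathbb{Z}_2^n$. A quad is a set of four distinct cards $\vec a,\vec b,\vec c,\vec d$ with $\vec a+\vec b+\vec c+\vec d=\vec 0$. A no-quads set is a set of cards containing no quad. $F(n)$ is the maximum number of cards in a no-quads subset of $\mathbb{Z}_2^n$. $B(\ell)$ is the largest possible number of codewords in a linear binary code of length $\ell$ (a linear subspace of $\mathbb{Z}_2^\ell$) with minimum Hamming distance at least 6, i.e. every nonzero codeword has at least 6 ones (so $B(\ell)$ is a power of 2). *)

theory Defs
  imports "Jordan_Normal_Form.VS_Connect" "HOL-Library.Z2" Complex_Main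
begin

(* Z_2^n is carrier_vec n over the two-element field bit. *)

definition is_quad :: "nat \<Rightarrow> bit vec set \<Rightarrow> bool" where
  "is_quad n Q \<longleftrightarrow>
     (\<exists>a b c d. Q = {a, b, c, d} \<and> distinct [a, b, c, d] \<and> Q \<subseteq> carrier_vec n \<and>
                a + b + c + d = 0\<^sub>v n)"

definition no_quads :: "nat \<Rightarrow> bit vec set \<Rightarrow> bool" where
  "no_quads n S \<longleftrightarrow> S \<subseteq> carrier_vec n \<and> \<not> (\<exists>Q\<subseteq>S. is_quad n Q)"

definition F :: "nat \<Rightarrow> nat" where
  "F n = Max {card S |S. no_quads n S}"

definition hamming_dist :: "bit vec \<Rightarrow> bit vec \<Rightarrow> nat" where
  "hamming_dist x y = card {i. i < dim_vec x \<and> x $ i \<noteq> y $ i}"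

(* The zero code has no two distinct codewords and so satisfies every lower bound on the
   minimum distance; it is admitted here, which makes B l \<ge> 1 for every l. *)
definition min_dist_ge :: "nat \<Rightarrow> bit vec set \<Rightarrow> bool" where
  "min_dist_ge d C \<longleftrightarrow> (\<forall>x\<in>C. \<forall>y\<in>C. x \<noteq> y \<longrightarrow> d \<le> hamming_dist x y)"

definition linear_code :: "nat \<Rightarrow> bit vec set \<Rightarrow> bool" where
  "linear_code l C \<longleftrightarrow>
     VectorSpace.subspace (class_ring :: bit ring) C (module_vec TYPE(bit) l)"

definition B :: "nat \<Rightarrow> nat" where
  "B l = Max {card C |C. linear_code l C \<and> min_dist_ge 6 C}"

(* The sets under Max are finite and nonempty, so F and B are genuine maxima. *)

lemma finite_carrier_vec_bit: "finite (carrier_vec n :: bit vec set)"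
proof -
  have "carrier_vec n \<subseteq> vec_of_list ` {xs. set xs \<subseteq> (UNIV :: bit set) \<and> length xs = n}"
  proof
    fix v :: "bit vec" assume "v \<in> carrier_vec n"
    then have "v = vec_of_list (list_of_vec v)" "length (list_of_vec v) = n"
      by (auto simp: vec_list)
    then show "v \<in> vec_of_list ` {xs. set xs \<subseteq> (UNIV :: bit set) \<and> length xs = n}"
      by blast
  qed
  moreover have "finite (UNIV :: bit set)"
    by (rule finite_subset[of _ "{0, 1}"]) (auto intro: bit.exhaust)
  ultimately show ?thesis
    using finite_lists_length_eq[of "UNIV :: bit set" n] by (auto intro: finite_subset)
qed

lemma linear_code_iff:
  "linear_code l C \<longleftrightarrow>
     C \<subseteq> carrier_vec l \<and> 0\<^sub>v l \<in> C \<and> (\<forall>x\<in>C. \<forall>y\<in>C. x + y \<in> C)"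
proof
  assume "linear_code l C"
  then have "submodule (class_ring :: bit ring) C (module_vec TYPE(bit) l)"
    unfolding linear_code_def subspace_def by simp
  then show "C \<subseteq> carrier_vec l \<and> 0\<^sub>v l \<in> C \<and> (\<forall>x\<in>C. \<forall>y\<in>C. x + y \<in> C)"
    unfolding submodule_def by (auto simp: module_vec_simps)
next
  assume C: "C \<subseteq> carrier_vec l \<and> 0\<^sub>v l \<in> C \<and> (\<forall>x\<in>C. \<forall>y\<in>C. x + y \<in> C)"
  have smult: "c \<cdot>\<^sub>v x \<in> C" if "x \<in> C" for c :: bit and x
  proof (cases c)
    case zero
    have "0 \<cdot>\<^sub>v x = 0\<^sub>v l" using that C by (intro eq_vecI) auto
    then show ?thesis using zero C by simp
  next
    case one
    then show ?thesis using that by simp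
  qed
  have "submodule (class_ring :: bit ring) C (module_vec TYPE(bit) l)"
    unfolding submodule_def using C smult vec_module[where 'a = bit]
    by (auto simp: module_vec_simps)
  then show "linear_code l C"
    unfolding linear_code_def subspace_def using vec_vs[where 'a = bit] by simp
qed

lemma no_quads_F:
  shows "\<exists>S. no_quads n S \<and> card S = F n" and "no_quads n S \<Longrightarrow> card S \<le> F n"
proof -
  have "{card S |S. no_quads n S} \<subseteq> card ` Pow (carrier_vec n :: bit vec set)"
    by (auto simp: no_quads_def)
  then have fin: "finite {card S |S. no_quads n S}"
    by (rule finite_subset) (simp add: finite_carrier_vec_bit)
  have "no_quads n {}" by (auto simp: no_quads_def is_quad_def)
  then have "{card S |S. no_quads n S} \<noteq> {}" by blast
  from Max_in[OF fin this] show "\<exists>S. no_quads n S \<and> card S = F n"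
    unfolding F_def by auto
  show "no_quads n S \<Longrightarrow> card S \<le> F n"
    unfolding F_def using fin by (intro Max_ge) auto
qed

lemma linear_code_B:
  shows "\<exists>C. linear_code l C \<and> min_dist_ge 6 C \<and> card C = B l"
    and "linear_code l C \<Longrightarrow> min_dist_ge 6 C \<Longrightarrow> card C \<le> B l"
proof -
  let ?A = "{card C |C. linear_code l C \<and> min_dist_ge 6 C}"
  have "?A \<subseteq> card ` Pow (carrier_vec l :: bit vec set)"
    by (auto simp: linear_code_iff)
  then have fin: "finite ?A"
    by (rule finite_subset) (simp add: finite_carrier_vec_bit)
  have "linear_code l {0\<^sub>v l}" "min_dist_ge 6 {0\<^sub>v l}"
    by (auto simp: linear_code_iff min_dist_ge_def)
  then have "?A \<noteq> {}" by blast
  from Max_in[OF fin this] show "\<exists>C. linear_code l C \<and> min_dist_ge 6 C \<and> card C = B l"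
    unfolding B_def by auto
  show "linear_code l C \<Longrightarrow> min_dist_ge 6 C \<Longrightarrow> card C \<le> B l"
    unfolding B_def using fin by (intro Max_ge) auto
qed

lemma min_dist_ge_iff_weight:
  assumes "linear_code l C"
  shows "min_dist_ge d C \<longleftrightarrow> (\<forall>x\<in>C. x \<noteq> 0\<^sub>v l \<longrightarrow> d \<le> card {i. i < l \<and> x $ i = 1})"
proof -
  have C: "C \<subseteq> carrier_vec l" "0\<^sub>v l \<in> C" "\<And>x y. x \<in> C \<Longrightarrow> y \<in> C \<Longrightarrow> x + y \<in> C"
    using assms by (auto simp: linear_code_iff)
  have zero: "hamming_dist x (0\<^sub>v l) = card {i. i < l \<and> x $ i = 1}" if "x \<in> C" for x
    unfolding hamming_dist_def using that C(1) by (intro arg_cong[where f = card]) auto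
  have dist: "hamming_dist x y = card {i. i < l \<and> (x + y) $ i = 1}"
    and nz: "x \<noteq> y \<Longrightarrow> x + y \<noteq> 0\<^sub>v l" if "x \<in> C" "y \<in> C" for x y
  proof -
    have d: "dim_vec x = l" "dim_vec y = l" using that C(1) by auto
    have *: "(x + y) $ i = 1 \<longleftrightarrow> x $ i \<noteq> y $ i" if "i < l" for i
      using that d by (cases "x $ i"; cases "y $ i") auto
    then show "hamming_dist x y = card {i. i < l \<and> (x + y) $ i = 1}"
      unfolding hamming_dist_def using d by (intro arg_cong[where f = card]) auto
    show "x + y \<noteq> 0\<^sub>v l" if "x \<noteq> y"
    proof
      assume z: "x + y = 0\<^sub>v l"
      have "x $ i = y $ i" if "i < l" for i using *[OF that] z that by auto
      then show False using \<open>x \<noteq> y\<close> d by (auto intro: eq_vecI)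
    qed
  qed
  show ?thesis
    unfolding min_dist_ge_def using C(2,3) zero dist nz by metis
qed

end

theory Submission
  imports Defs
begin

text \<open>
  A code with minimum weight 6 contains no unit vector, so quotienting \<open>\<int>\<^sub>2\<^sup>l\<close> by the code together
  with the first unit vector costs one dimension more than quotienting by the code alone. Two or
  four unit vectors summing to zero in this quotient would yield a nonzero codeword of weight at
  most 5, so the \<open>l\<close> unit vectors map to distinct points containing no quad. Conversely, the
  even-weight relations among the points of a no-quads set form a code in which weights 2 and 4
  do not occur, and a dimension count bounds its size from below.
\<close>

section \<open>Additive maps between spaces of bit vectors\<close>

text \<open>Over the two-element field the only scalars are 0 and 1, so additivity alone already
  amounts to linearity.\<close>

definition additive_on :: "nat \<Rightarrow> nat \<Rightarrow> (bit vec \<Rightarrow> bit vec) \<Rightarrow> bool" where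
  "additive_on l m f \<longleftrightarrow>
     (\<forall>x\<in>carrier_vec l. f x \<in> carrier_vec m) \<and>
     (\<forall>x\<in>carrier_vec l. \<forall>y\<in>carrier_vec l. f (x + y) = f x + f y)"

text \<open>Multiplication by the matrix with columns \<open>v i\<close>. Its kernel consists of the
  linear relations among these columns, a relation being encoded by the indicator vector of the
  columns that it sums.\<close>

definition combination :: "nat \<Rightarrow> (nat \<Rightarrow> bit vec) \<Rightarrow> bit vec \<Rightarrow> bit vec" where
  "combination m v x = vec m (\<lambda>j. \<Sum>i<dim_vec x. x $ i * v i $ j)"

lemma bit_vec_add_self:
  fixes x :: "bit vec"
  assumes "x \<in> carrier_vec n"
  shows "x + x = 0\<^sub>v n"
  using assms by (intro eq_vecI) (auto simp flip: mult_2)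

lemma bit_vec_add_eq_zero_iff:
  fixes x y :: "bit vec"
  assumes "x \<in> carrier_vec n" "y \<in> carrier_vec n"
  shows "x + y = 0\<^sub>v n \<longleftrightarrow> x = y"
proof
  assume "x + y = 0\<^sub>v n"
  then have "x + y + y = y" using assms by simp
  then show "x = y"
    using assms by (simp add: assoc_add_vec[of x n y y] bit_vec_add_self)
qed (use assms in \<open>simp add: bit_vec_add_self\<close>)

lemma bit_vec_add_cancel:
  fixes x y :: "bit vec"
  assumes "x \<in> carrier_vec n" "y \<in> carrier_vec n"
  shows "x + y + y = x"
  using assms by (simp add: assoc_add_vec[of x n y y] bit_vec_add_self)

lemma card_carrier_vec_bit: "card (carrier_vec n :: bit vec set) = 2 ^ n"
proof -
  let ?L = "{xs. set xs \<subseteq> (UNIV :: bit set) \<and> length xs = n}"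
  have U: "(UNIV :: bit set) = {0, 1}" by (auto intro: bit.exhaust)
  have "bij_betw list_of_vec (carrier_vec n :: bit vec set) ?L"
    by (rule bij_betw_byWitness[where f' = vec_of_list])
      (auto simp: vec_list list_vec intro!: carrier_vecI)
  then have "card (carrier_vec n :: bit vec set) = card ?L"
    by (rule bij_betw_same_card)
  also have "\<dots> = card (UNIV :: bit set) ^ n"
    by (rule card_lists_length_eq) (simp add: U)
  also have "card (UNIV :: bit set) = 2" by (simp add: U)
  finally show ?thesis .
qed

lemma linear_codeD:
  assumes "linear_code l C"
  shows "C \<subseteq> carrier_vec l" "0\<^sub>v l \<in> C" "x \<in> C \<Longrightarrow> y \<in> C \<Longrightarrow> x + y \<in> C" "finite C"
  using assms finite_subset[OF _ finite_carrier_vec_bit[of l]] by (auto simp: linear_code_iff)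

lemma additive_onD:
  assumes "additive_on l m f"
  shows "x \<in> carrier_vec l \<Longrightarrow> f x \<in> carrier_vec m"
    and "x \<in> carrier_vec l \<Longrightarrow> y \<in> carrier_vec l \<Longrightarrow> f (x + y) = f x + f y"
    and "f (0\<^sub>v l) = 0\<^sub>v m"
    and "x \<in> carrier_vec l \<Longrightarrow> y \<in> carrier_vec l \<Longrightarrow> f x = f y \<longleftrightarrow> f (x + y) = 0\<^sub>v m"
proof -
  show clo: "f x \<in> carrier_vec m" if "x \<in> carrier_vec l" for x
    using assms that by (simp add: additive_on_def)
  show add: "f (x + y) = f x + f y" if "x \<in> carrier_vec l" "y \<in> carrier_vec l" for x y
    using assms that by (simp add: additive_on_def)
  have "f (0\<^sub>v l + 0\<^sub>v l) = f (0\<^sub>v l) + f (0\<^sub>v l)" by (rule add) auto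
  also have "\<dots> = 0\<^sub>v m" by (rule bit_vec_add_self[OF clo]) auto
  finally show "f (0\<^sub>v l) = 0\<^sub>v m" by simp
  show "f x = f y \<longleftrightarrow> f (x + y) = 0\<^sub>v m" if "x \<in> carrier_vec l" "y \<in> carrier_vec l"
    using that by (simp add: add bit_vec_add_eq_zero_iff clo)
qed

lemma additive_on_combination: "additive_on l m (combination m v)"
  unfolding additive_on_def combination_def
  by (auto intro!: eq_vecI simp: sum.distrib distrib_right simp del: add_bit_eq_xor mult_bit_eq_and)

lemma linear_code_kernel:
  assumes "additive_on l m f"
  shows "linear_code l {x \<in> carrier_vec l. f x = 0\<^sub>v m}"
  using additive_onD[OF assms] by (auto simp: linear_code_iff)

lemma linear_code_image:
  assumes "additive_on l m f" "linear_code l C"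
  shows "linear_code m (f ` C)"
proof -
  note f = additive_onD[OF assms(1)] and C = linear_codeD[OF assms(2)]
  have "f x + f y \<in> f ` C" if "x \<in> C" "y \<in> C" for x y
    using that C f(2)[of x y] by (metis image_eqI subsetD)
  moreover have "0\<^sub>v m \<in> f ` C" using f(3) C(2) by (metis image_eqI)
  ultimately show ?thesis using f(1) C(1) by (auto simp: linear_code_iff)
qed

text \<open>Rank-nullity in counting form. Translation by a point of a fibre is its own inverse in
  characteristic 2 and carries that fibre onto the kernel, so all fibres over the image are equally
  large.\<close>

lemma card_code_eq_kernel_times_image:
  assumes "additive_on l m f" "linear_code l C"
  shows "card C = card {x \<in> C. f x = 0\<^sub>v m} * card (f ` C)"
proof -
  note f = additive_onD[OF assms(1)] and C = linear_codeD[OF assms(2)]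
  let ?K = "{x \<in> C. f x = 0\<^sub>v m}"
  have fibre: "card {x \<in> C. f x = y} = card ?K" if "y \<in> f ` C" for y
  proof -
    from that obtain z where z: "z \<in> C" "y = f z" by auto
    have carr: "x \<in> carrier_vec l" if "x \<in> C" for x using C(1) that by auto
    have "bij_betw (\<lambda>x. x + z) {x \<in> C. f x = y} ?K"
    proof (rule bij_betw_byWitness[where f' = "\<lambda>x. x + z"])
      show "\<forall>a\<in>{x \<in> C. f x = y}. a + z + z = a" "\<forall>a\<in>?K. a + z + z = a"
        using carr z(1) by (auto intro: bit_vec_add_cancel)
      show "(\<lambda>x. x + z) ` {x \<in> C. f x = y} \<subseteq> ?K"
        using carr z C(3) f(4) by auto
      show "(\<lambda>x. x + z) ` ?K \<subseteq> {x \<in> C. f x = y}"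
        using carr z C(3) f(1,2) by auto
    qed
    then show ?thesis by (rule bij_betw_same_card)
  qed
  have "card C = (\<Sum>y\<in>f ` C. card {x \<in> C. f x = y})"
    using sum.image_gen[OF C(4), of "\<lambda>_. 1::nat" f] by simp
  also have "\<dots> = card ?K * card (f ` C)" using fibre by simp
  finally show ?thesis .
qed

lemma card_kernel_ge:
  assumes "additive_on l m f"
  shows "2 ^ l \<le> card {x \<in> carrier_vec l. f x = 0\<^sub>v m} * 2 ^ m"
proof -
  have "linear_code l (carrier_vec l)" by (auto simp: linear_code_iff)
  from card_code_eq_kernel_times_image[OF assms this]
  have "2 ^ l = card {x \<in> carrier_vec l. f x = 0\<^sub>v m} * card (f ` carrier_vec l)"
    by (simp add: card_carrier_vec_bit)
  also have "card (f ` carrier_vec l) \<le> 2 ^ m"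
    using card_mono[OF finite_carrier_vec_bit, of "f ` carrier_vec l" m] additive_onD(1)[OF assms]
    by (auto simp: card_carrier_vec_bit)
  finally show ?thesis by simp
qed

section \<open>Quotients of spaces of bit vectors\<close>

text \<open>Quotient by a line: pick a coordinate \<open>p\<close> with \<open>v $ p = 1\<close>,
  replace \<open>x\<close> by \<open>x + x $ p * v\<close>, whose coordinate \<open>p\<close>
  vanishes, and delete that coordinate.\<close>

lemma projection_along_vector:
  fixes v :: "bit vec"
  assumes v: "v \<in> carrier_vec (Suc l)" "v \<noteq> 0\<^sub>v (Suc l)"
  shows "\<exists>f. additive_on (Suc l) l f \<and>
             (\<forall>x\<in>carrier_vec (Suc l). f x = 0\<^sub>v l \<longleftrightarrow> x = 0\<^sub>v (Suc l) \<or> x = v)"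
proof -
  have "\<exists>p<Suc l. v $ p = 1"
  proof (rule ccontr)
    assume "\<not> (\<exists>p<Suc l. v $ p = 1)"
    then have "v = 0\<^sub>v (Suc l)" using v(1) by (intro eq_vecI) auto
    with v(2) show False ..
  qed
  then obtain p where p: "p < Suc l" "v $ p = 1" by auto
  \<comment> \<open>\<open>?s\<close> enumerates the indices below \<open>Suc l\<close> other than
    \<open>p\<close>.\<close>
  let ?s = "\<lambda>j. if j < p then j else Suc j"
  let ?f = "\<lambda>x :: bit vec. vec l (\<lambda>j. x $ ?s j + x $ p * v $ ?s j)"
  have "additive_on (Suc l) l ?f"
    unfolding additive_on_def using p(1)
    by (auto intro!: eq_vecI simp: distrib_right ac_simps simp del: add_bit_eq_xor mult_bit_eq_and)
  moreover have "?f x = 0\<^sub>v l \<longleftrightarrow> x = 0\<^sub>v (Suc l) \<or> x = v" if x: "x \<in> carrier_vec (Suc l)" for x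
  proof
    assume f0: "?f x = 0\<^sub>v l"
    have s: "x $ ?s j + x $ p * v $ ?s j = 0" if "j < l" for j
      using arg_cong[OF f0, of "\<lambda>w. w $ j"] that by simp
    \<comment> \<open>The deleted coordinate vanishes as well, because \<open>v $ p = 1\<close>
      turns it into twice \<open>x $ p\<close>. Hence \<open>x\<close> equals \<open>x $ p\<close>
      times \<open>v\<close>.\<close>
    have all: "x $ i + x $ p * v $ i = 0" if i: "i < Suc l" for i
    proof -
      consider "i < p" | "i = p" | "i > p" by linarith
      then show ?thesis
      proof cases
        case 1
        then show ?thesis using s[of i] p by simp
      next
        case 2
        then show ?thesis using p by (simp flip: mult_2)
      next
        case 3
        then have "?s (i - 1) = i" "i - 1 < l" using i by auto
        with s[of "i - 1"] show ?thesis by simp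
      qed
    qed
    show "x = 0\<^sub>v (Suc l) \<or> x = v"
    proof (cases "x $ p")
      case zero
      then have "x = 0\<^sub>v (Suc l)" using x all by (intro eq_vecI) auto
      then show ?thesis ..
    next
      case one
      then have "x + v = 0\<^sub>v (Suc l)" using x v(1) all by (intro eq_vecI) auto
      then show ?thesis using x v(1) by (simp add: bit_vec_add_eq_zero_iff)
    qed
  next
    assume "x = 0\<^sub>v (Suc l) \<or> x = v"
    then show "?f x = 0\<^sub>v l"
      using p by (auto intro!: eq_vecI simp flip: mult_2)
  qed
  ultimately show ?thesis by blast
qed

text \<open>Realises the quotient by \<open>K\<close> as a concrete space of bit vectors and shows
  that the size of \<open>K\<close> is a power of 2. By induction on the length: project along a
  nonzero \<open>v\<close> in \<open>K\<close>, apply the hypothesis to the image of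
  \<open>K\<close>, and compose the two maps.\<close>

lemma linear_code_is_kernel:
  assumes "linear_code l K"
  shows "\<exists>m f. m \<le> l \<and> additive_on l m f \<and> card K = 2 ^ (l - m) \<and>
               (\<forall>x\<in>carrier_vec l. f x = 0\<^sub>v m \<longleftrightarrow> x \<in> K)"
  using assms
proof (induction l arbitrary: K)
  case 0
  note K = linear_codeD[OF this]
  have "x = 0\<^sub>v 0" if "x \<in> carrier_vec 0" for x :: "bit vec"
    using that by (intro eq_vecI) auto
  then have "K = {0\<^sub>v 0}" "K = carrier_vec 0" using K by auto
  then show ?case
    by (intro exI[of _ 0] exI[of _ "\<lambda>x. x"]) (auto simp: additive_on_def)
next
  case (Suc l)
  note K = linear_codeD[OF Suc.prems]
  show ?case
  proof (cases "K = {0\<^sub>v (Suc l)}")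
    case True
    then show ?thesis
      by (intro exI[of _ "Suc l"] exI[of _ "\<lambda>x. x"]) (auto simp: additive_on_def)
  next
    case False
    with K obtain v where v: "v \<in> K" "v \<noteq> 0\<^sub>v (Suc l)" by blast
    then obtain p where p: "additive_on (Suc l) l p"
      and kerp: "\<And>x. x \<in> carrier_vec (Suc l) \<Longrightarrow> p x = 0\<^sub>v l \<longleftrightarrow> x = 0\<^sub>v (Suc l) \<or> x = v"
      using projection_along_vector[of v l] K(1) by blast
    obtain m f where f: "m \<le> l" "additive_on l m f" "card (p ` K) = 2 ^ (l - m)"
      and kerf: "\<And>x. x \<in> carrier_vec l \<Longrightarrow> f x = 0\<^sub>v m \<longleftrightarrow> x \<in> p ` K"
      using Suc.IH[OF linear_code_image[OF p Suc.prems]] by blast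
    \<comment> \<open>Exactly two elements of \<open>K\<close> are killed by \<open>p\<close>, so
      \<open>K\<close> is twice as large as its image; this matches the increase of the length by
      one.\<close>
    have "{x \<in> K. p x = 0\<^sub>v l} = {0\<^sub>v (Suc l), v}"
      using K v kerp by auto
    then have "card K = 2 ^ (Suc l - m)"
      using card_code_eq_kernel_times_image[OF p Suc.prems] v f(1,3) by (simp add: Suc_diff_le)
    moreover have "additive_on (Suc l) m (f \<circ> p)"
      using additive_onD(1,2)[OF p] additive_onD(1,2)[OF f(2)] by (auto simp: additive_on_def)
    moreover have "(f \<circ> p) x = 0\<^sub>v m \<longleftrightarrow> x \<in> K" if x: "x \<in> carrier_vec (Suc l)" for x
    proof
      assume "(f \<circ> p) x = 0\<^sub>v m"
      then have "p x \<in> p ` K" using kerf x additive_onD(1)[OF p] by auto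
      \<comment> \<open>Membership of \<open>p x\<close> in the image only yields agreement with
        some \<open>y\<close> in \<open>K\<close> up to \<open>v\<close>; this suffices since
        \<open>v\<close> itself lies in \<open>K\<close>.\<close>
      then obtain y where y: "y \<in> K" "p x = p y" by auto
      have yc: "y \<in> carrier_vec (Suc l)" using y K by auto
      then have "x + y = 0\<^sub>v (Suc l) \<or> x + y = v"
        using y additive_onD(4)[OF p x yc] kerp x by auto
      then have "x + y \<in> K" using K v by auto
      then have "x + y + y \<in> K" using K(3) y by auto
      then show "x \<in> K" using bit_vec_add_cancel[OF x yc] by simp
    next
      assume "x \<in> K"
      then show "(f \<circ> p) x = 0\<^sub>v m" using kerf additive_onD(1)[OF p x] by auto
    qed
    ultimately show ?thesis
      using f(1) le_SucI by blast
  qed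
qed

section \<open>From codes to no-quads sets\<close>

text \<open>Adjoining \<open>?e 0\<close> doubles the code and so saves one dimension in the target.
  Minimum weight 6 leaves room for this: it changes weights by one, and only vectors of weight at
  most 4 must be kept out.\<close>

lemma no_quads_from_code:
  assumes l: "l > 0" and C: "linear_code l C" "min_dist_ge 6 C"
  shows "\<exists>m S. m < l \<and> card C = 2 ^ (l - m - 1) \<and> no_quads m S \<and> card S = l"
proof -
  note Cd = linear_codeD[OF C(1)]
  let ?e = "unit_vec l :: nat \<Rightarrow> bit vec"
  let ?C' = "C \<union> (\<lambda>x. x + ?e 0) ` C"
  \<comment> \<open>A set of at most 5 positions covering the support forces a codeword to vanish;
    the support itself need not be computed.\<close>
  have weight: "x = 0\<^sub>v l" if "x \<in> C" "{i. i < l \<and> x $ i = 1} \<subseteq> T" "finite T" "card T \<le> 5" for x T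
    using C(2) that card_mono[OF that(3,2)]
    unfolding min_dist_ge_iff_weight[OF C(1)] by fastforce
  have cancel: "x + ?e 0 + ?e 0 = x" if "x \<in> carrier_vec l" for x
    using that by (intro bit_vec_add_cancel) auto
  have C': "linear_code l ?C'"
  proof -
    have "x + y \<in> ?C'" if "x \<in> ?C'" "y \<in> ?C'" for x y
    proof -
      have shift: "a + ?e 0 + b = a + b + ?e 0" if "a \<in> C" "b \<in> C" for a b
        using that Cd(1) by (intro eq_vecI) (auto simp: algebra_simps)
      have shift2: "a + ?e 0 + (b + ?e 0) = a + b" if "a \<in> C" "b \<in> C" for a b
      proof -
        have "a \<in> carrier_vec l" "b \<in> carrier_vec l" using that Cd(1) by auto
        then have "a + ?e 0 + (b + ?e 0) = a + b + ?e 0 + ?e 0"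
          by (intro eq_vecI) (auto simp: algebra_simps)
        then show ?thesis using cancel \<open>a \<in> carrier_vec l\<close> \<open>b \<in> carrier_vec l\<close> by simp
      qed
      have assoc: "a + (b + ?e 0) = a + b + ?e 0" if "a \<in> C" "b \<in> C" for a b
        using that Cd(1) by (intro eq_vecI) (auto simp: algebra_simps)
      from that show ?thesis using Cd(3) shift shift2 assoc by auto
    qed
    then show ?thesis using Cd(1,2) by (auto simp: linear_code_iff)
  qed
  \<comment> \<open>The lower bound 2 excludes \<open>?e 0\<close>, which does lie in
    \<open>?C'\<close>. The upper bound 4 leaves space for position 0 among the 5 allowed.\<close>
  have small: "x \<notin> ?C'"
    if x: "x \<in> carrier_vec l" and T: "{i. i < l \<and> x $ i = 1} = T" "2 \<le> card T" "card T \<le> 4" for x T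
  proof
    assume "x \<in> ?C'"
    have fT: "finite T" using T by auto
    have card5: "card (insert 0 T) \<le> 5" using T(3) card_insert_le_m1[of 5 T 0] by simp
    \<comment> \<open>A nonzero position of the support is unaffected by adding \<open>?e 0\<close>,
      so the codeword recovered from \<open>x\<close> is still nonzero there.\<close>
    have "\<not> T \<subseteq> {0}" using T(2) card_mono[of "{0}" T] by auto
    then obtain i where i: "i \<in> T" "i \<noteq> 0" by auto
    then have xi: "i < l" "x $ i = 1" using T(1) by auto
    from \<open>x \<in> ?C'\<close> show False
    proof
      assume "x \<in> C"
      then have "x = 0\<^sub>v l" using T card5 by (intro weight[of _ "insert 0 T"]) auto
      then show False using xi by simp
    next
      assume "x \<in> (\<lambda>x. x + ?e 0) ` C"
      then obtain y where y: "y \<in> C" "x = y + ?e 0" by auto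
      then have yx: "y $ j = x $ j" if "j < l" "j \<noteq> 0" for j
        using that Cd(1) by auto
      have "{i. i < l \<and> y $ i = 1} \<subseteq> insert 0 T"
        using yx T(1) by auto
      then have "y = 0\<^sub>v l" using y fT card5 by (intro weight[of _ "insert 0 T"]) auto
      then show False using xi i yx by auto
    qed
  qed
  obtain m f where m: "m \<le> l" and f: "additive_on l m f" and cardC': "card ?C' = 2 ^ (l - m)"
    and ker: "\<And>x. x \<in> carrier_vec l \<Longrightarrow> f x = 0\<^sub>v m \<longleftrightarrow> x \<in> ?C'"
    using linear_code_is_kernel[OF C'] by blast
  note fD = additive_onD[OF f]
  \<comment> \<open>A common element would put \<open>?e 0\<close>, of weight 1, into
    \<open>C\<close>.\<close>
  have disj: "C \<inter> (\<lambda>x. x + ?e 0) ` C = {}"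
  proof (rule ccontr)
    assume "C \<inter> (\<lambda>x. x + ?e 0) ` C \<noteq> {}"
    then obtain x where x: "x \<in> C" "x + ?e 0 \<in> C" by auto
    have xc: "x \<in> carrier_vec l" using x Cd by auto
    have "x + (x + ?e 0) \<in> C" using Cd(3) x by auto
    moreover have "x + (x + ?e 0) = ?e 0"
      using xc bit_vec_add_self[OF xc] by (simp add: assoc_add_vec[of x l x, symmetric])
    ultimately have "?e 0 = 0\<^sub>v l" by (intro weight[of _ "{0}"]) (auto split: if_splits)
    then show False using l by (metis index_unit_vec(2) index_zero_vec(1) zero_neq_one)
  qed
  have "inj_on (\<lambda>x. x + ?e 0) C"
    using cancel Cd(1) by (intro inj_on_inverseI[where g = "\<lambda>x. x + ?e 0"]) auto
  then have "card ?C' = 2 * card C"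
    using disj Cd(4) by (simp add: card_Un_disjoint card_image)
  with cardC' have pow: "2 * card C = 2 ^ (l - m)" by simp
  \<comment> \<open>Otherwise \<open>2 * card C\<close> would equal 1.\<close>
  have "m \<noteq> l" using pow by (intro notI) (use dvd_triv_left[of 2 "card C"] in auto)
  with m have ml: "m < l" by simp
  then have "l - m = Suc (l - m - 1)" by simp
  with pow have cardC: "card C = 2 ^ (l - m - 1)" by (metis power_Suc mult_cancel1 zero_neq_numeral)
  have inj: "inj_on (\<lambda>i. f (?e i)) {..<l}"
  proof (rule inj_onI, rule ccontr)
    fix i j assume ij: "i \<in> {..<l}" "j \<in> {..<l}" "f (?e i) = f (?e j)" "i \<noteq> j"
    then have "?e i + ?e j \<in> ?C'"
      using fD(4)[of "?e i" "?e j"] ker[of "?e i + ?e j"] by auto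
    moreover have "{k. k < l \<and> (?e i + ?e j) $ k = 1} = {i, j}"
      using ij by (auto split: if_splits)
    ultimately show False using small[of "?e i + ?e j" "{i, j}"] ij by auto
  qed
  let ?S = "(\<lambda>i. f (?e i)) ` {..<l}"
  have "no_quads m ?S"
    unfolding no_quads_def
  proof (intro conjI notI)
    show "?S \<subseteq> carrier_vec m" using fD(1) by auto
    assume "\<exists>Q\<subseteq>?S. is_quad m Q"
    then obtain Q where Q: "Q \<subseteq> ?S" "is_quad m Q" by (elim exE conjE)
    from Q(2) obtain a b c d where q: "Q = {a, b, c, d}" "distinct [a, b, c, d]"
      "a + b + c + d = 0\<^sub>v m"
      unfolding is_quad_def by (elim exE conjE)
    from Q(1) have "a \<in> ?S" "b \<in> ?S" "c \<in> ?S" "d \<in> ?S" unfolding q(1) by simp_all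
    from imageE[OF this(1)] imageE[OF this(2)] imageE[OF this(3)] imageE[OF this(4)]
    obtain i j k h where ix: "i < l" "j < l" "k < l" "h < l"
      "a = f (?e i)" "b = f (?e j)" "c = f (?e k)" "d = f (?e h)"
      unfolding lessThan_iff by metis
    then have dist: "distinct [i, j, k, h]" using q(2) by auto
    \<comment> \<open>A quad in the image lifts to a vector of weight 4 in the kernel
      \<open>?C'\<close>, against \<open>small\<close>.\<close>
    let ?x = "?e i + ?e j + ?e k + ?e h"
    have "f ?x = 0\<^sub>v m" using q(3) ix by (simp add: fD(2))
    then have "?x \<in> ?C'" using ker[of ?x] by auto
    moreover have "{n. n < l \<and> ?x $ n = 1} = {i, j, k, h}"
      using ix dist by (auto split: if_splits)
    ultimately show False using small[of ?x "{i, j, k, h}"] dist by auto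
  qed
  moreover have "card ?S = l" using inj by (simp add: card_image)
  ultimately show ?thesis using ml cardC by blast
qed

section \<open>From no-quads sets to codes\<close>

lemma card_eq_4E:
  assumes "card T = 4"
  obtains a b c d where "T = {a, b, c, d}" "distinct [a, b, c, d]"
proof -
  have "finite T" using assms by (metis card.infinite zero_neq_numeral)
  then obtain xs where xs: "set xs = T" "distinct xs" using finite_distinct_list by blast
  then have "length xs = 4" using assms distinct_card by fastforce
  then obtain a b c d where "xs = [a, b, c, d]"
    by (auto simp: numeral_eq_Suc length_Suc_conv)
  with xs that show thesis by auto
qed

text \<open>The codewords are the even-sized subsets of \<open>N\<close> chosen points that sum to
  zero. Size 2 would identify two points and size 4 would be a quad, so nonzero weights start at 6.
  There are \<open>Suc n\<close> parity checks, which gives the size bound.\<close>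

lemma code_from_no_quads:
  assumes S: "no_quads n S" "N \<le> card S"
  shows "\<exists>D. linear_code N D \<and> min_dist_ge 6 D \<and> 2 ^ N \<le> card D * 2 ^ Suc n"
proof -
  have SC: "S \<subseteq> carrier_vec n" using S(1) by (simp add: no_quads_def)
  then have "finite S" using finite_carrier_vec_bit finite_subset by blast
  then obtain s where "bij_betw s {..<card S} S"
    using ex_bij_betw_nat_finite[of S] by (auto simp: atLeast0LessThan)
  then have s: "inj_on s {..<N}" "s ` {..<N} \<subseteq> S"
    using S(2) by (auto simp: bij_betw_def inj_on_def)
  have sc: "s i \<in> carrier_vec n" if "i < N" for i using s(2) SC that by auto
  have sd: "dim_vec (s i) = n" if "i < N" for i using sc[OF that] by simp
  \<comment> \<open>The extra coordinate 1 forces every relation to have even weight.\<close>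
  let ?v = "\<lambda>i. vec (Suc n) (\<lambda>j. if j < n then s i $ j else 1)"
  let ?f = "combination (Suc n) ?v"
  let ?D = "{x \<in> carrier_vec N. ?f x = 0\<^sub>v (Suc n)}"
  have f: "additive_on N (Suc n) ?f" by (rule additive_on_combination)
  have D: "linear_code N ?D" by (rule linear_code_kernel[OF f])
  have "6 \<le> card {i. i < N \<and> x $ i = 1}" if x: "x \<in> ?D" "x \<noteq> 0\<^sub>v N" for x
  proof (rule ccontr)
    let ?T = "{i. i < N \<and> x $ i = 1}"
    assume less: "\<not> 6 \<le> card ?T"
    have sumT: "(\<Sum>i\<in>?T. ?v i $ j) = 0" if "j < Suc n" for j
    proof -
      have "(\<Sum>i\<in>?T. ?v i $ j) = (\<Sum>i<N. x $ i * ?v i $ j)"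
        by (rule sum.mono_neutral_cong_left) auto
      also have "\<dots> = ?f x $ j" using that x(1)
        unfolding combination_def by (subst index_vec) auto
      also have "\<dots> = 0" using that x(1) by simp
      finally show ?thesis .
    qed
    have sumS: "(\<Sum>i\<in>?T. s i $ j) = 0" if "j < n" for j
      using sumT[of j] that by simp
    \<comment> \<open>All summands in the extra coordinate are 1, so its sum is the parity of the
      weight.\<close>
    have "of_nat (card ?T) = (0::bit)" using sumT[of n] by simp
    then have even: "even (card ?T)" by (metis even_of_nat even_zero)
    have "?T \<noteq> {}"
    proof
      assume "?T = {}"
      then have "x = 0\<^sub>v N" using x(1) by (intro eq_vecI) auto
      with x(2) show False ..
    qed
    then have "card ?T \<noteq> 0" by simp
    with even less have "card ?T = 2 \<or> card ?T = 4" by presburger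
    then show False
    proof
      assume "card ?T = 2"
      then obtain a b where ab: "?T = {a, b}" "a \<noteq> b" by (auto simp: card_2_iff)
      then have N: "a < N" "b < N" by auto
      have "(s a + s b) $ j = 0" if "j < n" for j
        using sumS[OF that] that sd N ab(2) unfolding ab(1) by simp
      then have "s a + s b = 0\<^sub>v n" using sd N by (intro eq_vecI) auto
      then have "s a = s b" using sc N by (simp add: bit_vec_add_eq_zero_iff)
      then show False using s(1) N ab(2) by (auto dest: inj_onD)
    next
      assume "card ?T = 4"
      then obtain a b c d where T: "?T = {a, b, c, d}" "distinct [a, b, c, d]"
        by (rule card_eq_4E)
      then have N: "a < N" "b < N" "c < N" "d < N" by auto
      have "(s a + s b + s c + s d) $ j = 0" if "j < n" for j
        using sumS[OF that] that sd N T(2) unfolding T(1)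
        by (simp add: add.assoc del: add_bit_eq_xor)
      then have "s a + s b + s c + s d = 0\<^sub>v n" using sd N by (intro eq_vecI) auto
      moreover have "distinct [s a, s b, s c, s d]"
        using T(2) N s(1) by (auto dest: inj_onD)
      ultimately have "is_quad n {s a, s b, s c, s d}"
        unfolding is_quad_def using N sc
        by (intro exI[of _ "s a"] exI[of _ "s b"] exI[of _ "s c"] exI[of _ "s d"]) simp
      moreover have "{s a, s b, s c, s d} \<subseteq> S" using s(2) N by auto
      ultimately show False using S(1) unfolding no_quads_def by blast
    qed
  qed
  then have "min_dist_ge 6 ?D" unfolding min_dist_ge_iff_weight[OF D] by blast
  with D card_kernel_ge[OF f] show ?thesis by blast
qed

text \<open>The witness \<open>n\<close> is the dimension of the quotient built from an optimal code
  of length \<open>l\<close>. If \<open>F n\<close> exceeded \<open>l\<close>, then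
  \<open>l + 1\<close> points without a quad would yield a code of length \<open>l + 1\<close> with
  at least \<open>2 ^ (l - n)\<close> words, twice \<open>B l\<close>, which contradicts
  \<open>B l = B (l + 1)\<close>.\<close>

theorem theorem9:
  fixes l :: nat
  assumes "l > 0"
  shows "\<exists>n::nat. real n = real l - log 2 (real (B l)) - 1 \<and>
           F n \<ge> l \<and>
           (B l = B (l + 1) \<longrightarrow> F n = l)"
proof -
  obtain C where C: "linear_code l C" "min_dist_ge 6 C" "card C = B l"
    using linear_code_B(1) by blast
  then obtain n S where n: "n < l" "B l = 2 ^ (l - n - 1)" and S: "no_quads n S" "card S = l"
    using no_quads_from_code[OF assms C(1,2)] by auto
  have ge: "l \<le> F n" using no_quads_F(2)[OF S(1)] S(2) by simp
  have "F n = l" if eq: "B l = B (l + 1)"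
  proof (rule ccontr)
    assume "F n \<noteq> l"
    with ge have big: "l + 1 \<le> F n" by simp
    obtain S' where S': "no_quads n S'" "card S' = F n" using no_quads_F(1) by blast
    with big obtain D where D: "linear_code (l + 1) D" "min_dist_ge 6 D"
      "2 ^ (l + 1) \<le> card D * 2 ^ Suc n"
      using code_from_no_quads[of n S' "l + 1"] by auto
    have "card D \<le> 2 ^ (l - n - 1)" using linear_code_B(2)[OF D(1,2)] eq n(2) by simp
    then have "card D * 2 ^ Suc n \<le> 2 ^ (l - n - 1) * 2 ^ Suc n" by (rule mult_right_mono) simp
    also have "\<dots> = 2 ^ (l - n - 1 + Suc n)" by (rule power_add[symmetric])
    also have "\<dots> = 2 ^ l" using n(1) by simp
    finally have "(2::nat) ^ (l + 1) \<le> 2 ^ l" using D(3) by linarith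
    then show False by simp
  qed
  \<comment> \<open>Since \<open>n < l\<close>, the truncated subtraction in the exponent of
    \<open>B l\<close> is a true one.\<close>
  moreover have "real n = real l - log 2 (real (B l)) - 1"
    using n by (simp add: log_nat_power of_nat_diff)
  ultimately show ?thesis using ge by blast
qed

end
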